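(* Let $\gamma>0$ and let $(\theta^{[t]})_{t\ge 1}\subset\mathcal M$ be the sequence generated from an initial value $\theta^{[1]}\in\mathcal M$ by $\theta^{[t+1]}:=\Gamma^{(e),\phi}_{\mathcal M}(\mathcal F_\gamma(\theta^{[t]}))$. Assume that for every $t\ge 1$ $$D_\Omega(\theta^{[t+1]}\|\theta^{[t]})\le \gamma\, D^\phi(\theta^{[t+1]}\|\theta^{[t]}).$$ Then the algorithm always iteratively improves the value of the objective function, i.e. $\mathcal G(\theta^{[t+1]})\le \mathcal G(\theta^{[t]})$ for every $t\ge 1$.
   Context: Bregman system: $\Theta\subset\mathbb R^d$ is an open convex set and $\phi:\Theta\to\mathbb R$ is a $C^2$ strictly convex function. For $\theta\in\Theta$ put $\eta_j(\theta):=\partial\phi/\partial\theta^j(\theta)$, $\eta(\theta)=(\eta_1(\theta),\dots,\eta_d(\theta))$ (the map $\theta\mapsto\eta(\theta)$ is injective). The Bregman divergence is $$D^\phi(\theta_1\|\theta_2):=\sum_{j=1}^d\eta_j(\theta_1)(\theta_1^j-\theta_2^j)-\phi(\theta_1)+\phi(\theta_2),\qquad \theta_1,\theta_2\in\Theta.$$ Mixture family: given linearly independent vectors $u_1,\dots,u_d\in\mathbb R^d$, $k=d-d_0$, and $c\in\mathbb R^k$, $\mathcal M:=\{\theta\in\Theta:\ \sum_{i=1}^d u^i_{d_0+j}\,\partial_i\phi(\theta)=c_j,\ j=1,\dots,k\}$. e-projection: for $\bar\theta\in\Theta$, $\Gamma^{(e),\phi}_{\mathcal M}(\bar\theta):=\operatorname{argmin}_{\theta'\in\mathcal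 M}D^\phi(\theta'\|\bar\theta)$; it is assumed that this minimizer exists whenever the e-projection is used. Objective function: the set $\mathcal D:=\{\eta(\theta):\theta\in\mathcal M\}\subset\mathbb R^d$ is assumed convex, $\tilde\Omega=(\tilde\Omega^1,\dots,\tilde\Omega^d):\mathcal D\to\mathbb R^d$ is a function, and for $\theta\in\mathcal M$ we set $\Omega(\theta):=\tilde\Omega(\eta(\theta))$ and $\mathcal G(\theta):=\sum_{j=1}^d\eta_j(\theta)\Omega^j(\theta)$. For $\theta,\theta'\in\mathcal M$, $D_\Omega(\theta\|\theta'):=\sum_{j=1}^d\eta_j(\theta)\big(\Omega^j(\theta)-\Omega^j(\theta')\big)$. Conversion function: $\mathcal F_\gamma(\theta):=\theta-\frac1\gamma\Omega(\theta)$, assumed to take values in $\Theta$. *)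

theory Defs
  imports "HOL-Analysis.Analysis"
begin

definition partial_deriv :: "'d::finite \<Rightarrow> (real^'d \<Rightarrow> real) \<Rightarrow> real^'d \<Rightarrow> real" where
  "partial_deriv i f x = deriv (\<lambda>s. f (x + s *\<^sub>R axis i 1)) 0"

text \<open>The following two notions are meant for open \<open>S\<close>; existence of the partial derivatives is
  required separately because \<^const>\<open>deriv\<close> is total.\<close>

definition C1_on :: "(real^'d::finite) set \<Rightarrow> (real^'d \<Rightarrow> real) \<Rightarrow> bool" where
  "C1_on S f \<longleftrightarrow>
     (\<forall>i. (\<forall>x\<in>S. (\<lambda>s. f (x + s *\<^sub>R axis i 1)) differentiable (at (0::real))) \<and>
          continuous_on S (partial_deriv i f))"

definition C2_on :: "(real^'d::finite) set \<Rightarrow> (real^'d \<Rightarrow> real) \<Rightarrow> bool" where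
  "C2_on S f \<longleftrightarrow> C1_on S f \<and> (\<forall>i. C1_on S (partial_deriv i f))"

definition strictly_convex_on :: "'a::real_vector set \<Rightarrow> ('a \<Rightarrow> real) \<Rightarrow> bool" where
  "strictly_convex_on S f \<longleftrightarrow> convex S \<and>
     (\<forall>x\<in>S. \<forall>y\<in>S. x \<noteq> y \<longrightarrow>
       (\<forall>u>0. \<forall>v>0. u + v = 1 \<longrightarrow> f (u *\<^sub>R x + v *\<^sub>R y) < u * f x + v * f y))"

text \<open>Functions defined on \<open>\<Theta>\<close> only are represented by total functions of which
  just the values on the open set \<open>\<Theta>\<close> matter.\<close>

definition bregman_system :: "(real^'d::finite) set \<Rightarrow> (real^'d \<Rightarrow> real) \<Rightarrow> bool" where
  "bregman_system \<Theta> \<phi> \<longleftrightarrow>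
     open \<Theta> \<and> convex \<Theta> \<and> C2_on \<Theta> \<phi> \<and> strictly_convex_on \<Theta> \<phi>"

definition eta :: "(real^'d::finite \<Rightarrow> real) \<Rightarrow> real^'d \<Rightarrow> real^'d" where
  "eta \<phi> \<theta> = (\<chi> j. partial_deriv j \<phi> \<theta>)"

definition bregman_div :: "(real^'d::finite \<Rightarrow> real) \<Rightarrow> real^'d \<Rightarrow> real^'d \<Rightarrow> real" where
  "bregman_div \<phi> \<theta>\<^sub>1 \<theta>\<^sub>2 =
     (\<Sum>j\<in>UNIV. eta \<phi> \<theta>\<^sub>1 $ j * (\<theta>\<^sub>1 $ j - \<theta>\<^sub>2 $ j)) - \<phi> \<theta>\<^sub>1 + \<phi> \<theta>\<^sub>2"

text \<open>The vectors \<open>u\<^sub>1, \<dots>, u\<^sub>d\<close> and the constants \<open>c\<^sub>1, \<dots>, c\<^sub>k\<close>, with \<open>k = d - d\<^sub>0\<close>,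
  are the values of \<open>u\<close> on \<open>{1..d}\<close> and of \<open>c\<close> on \<open>{1..k}\<close>; all other values are ignored.
  Injectivity is part of linear independence of the family, as opposed to its range.\<close>

definition lin_indep_family :: "(nat \<Rightarrow> real^'d::finite) \<Rightarrow> bool" where
  "lin_indep_family u \<longleftrightarrow>
     inj_on u {1..CARD('d)} \<and> independent (u ` {1..CARD('d)})"

definition mixture_family ::
  "(real^'d::finite) set \<Rightarrow> (real^'d \<Rightarrow> real) \<Rightarrow> (nat \<Rightarrow> real^'d) \<Rightarrow> nat \<Rightarrow> (nat \<Rightarrow> real)
    \<Rightarrow> (real^'d) set" where
  "mixture_family \<Theta> \<phi> u d\<^sub>0 c =
     {\<theta>\<in>\<Theta>. \<forall>j\<in>{1..CARD('d) - d\<^sub>0}. (\<Sum>i\<in>UNIV. u (d\<^sub>0 + j) $ i * partial_deriv i \<phi> \<theta>) = c j}"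

definition e_projection_exists ::
  "(real^'d::finite \<Rightarrow> real) \<Rightarrow> (real^'d) set \<Rightarrow> real^'d \<Rightarrow> bool" where
  "e_projection_exists \<phi> M \<theta>' \<longleftrightarrow>
     (\<exists>\<theta>. is_arg_min (\<lambda>\<theta>. bregman_div \<phi> \<theta> \<theta>') (\<lambda>\<theta>. \<theta> \<in> M) \<theta>)"

definition e_projection ::
  "(real^'d::finite \<Rightarrow> real) \<Rightarrow> (real^'d) set \<Rightarrow> real^'d \<Rightarrow> real^'d" where
  "e_projection \<phi> M \<theta>' = arg_min_on (\<lambda>\<theta>. bregman_div \<phi> \<theta> \<theta>') M"

text \<open>Below, \<open>W\<close> is the function \<open>\<Omega>\<close> expressed in the dual coordinate \<open>\<eta>\<close>.\<close>

definition Omega ::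
  "(real^'d::finite \<Rightarrow> real) \<Rightarrow> (real^'d \<Rightarrow> real^'d) \<Rightarrow> real^'d \<Rightarrow> real^'d" where
  "Omega \<phi> W \<theta> = W (eta \<phi> \<theta>)"

definition objective ::
  "(real^'d::finite \<Rightarrow> real) \<Rightarrow> (real^'d \<Rightarrow> real^'d) \<Rightarrow> real^'d \<Rightarrow> real" where
  "objective \<phi> W \<theta> = (\<Sum>j\<in>UNIV. eta \<phi> \<theta> $ j * Omega \<phi> W \<theta> $ j)"

definition D_Omega ::
  "(real^'d::finite \<Rightarrow> real) \<Rightarrow> (real^'d \<Rightarrow> real^'d) \<Rightarrow> real^'d \<Rightarrow> real^'d \<Rightarrow> real" where
  "D_Omega \<phi> W \<theta> \<theta>' =
     (\<Sum>j\<in>UNIV. eta \<phi> \<theta> $ j * (Omega \<phi> W \<theta> $ j - Omega \<phi> W \<theta>' $ j))"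

definition conversion ::
  "(real^'d::finite \<Rightarrow> real) \<Rightarrow> (real^'d \<Rightarrow> real^'d) \<Rightarrow> real \<Rightarrow> real^'d \<Rightarrow> real^'d" where
  "conversion \<phi> W \<gamma> \<theta> = \<theta> - (1 / \<gamma>) *\<^sub>R Omega \<phi> W \<theta>"

end

theory Submission
  imports Defs
begin

text \<open>Passing from \<open>\<theta>\<close> to the base point \<open>\<F>\<^sub>\<gamma>(\<theta>)\<close> adds to the divergence, up to a constant,
  the linear term \<open>\<eta>(\<cdot>) \<bullet> \<Omega>(\<theta>) / \<gamma>\<close>. Hence the e-projection minimises
  \<open>\<gamma> D\<^sup>\<phi>(\<cdot> \<parallel> \<theta>) + \<eta>(\<cdot>) \<bullet> \<Omega>(\<theta>)\<close>, which by the assumption on \<open>D\<^sub>\<Omega>\<close> majorises \<open>\<G>\<close> at the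
  minimiser and equals \<open>\<G>(\<theta>)\<close> at \<open>\<theta>\<close>.\<close>

lemma bregman_div_inner:
  "bregman_div \<phi> x y = eta \<phi> x \<bullet> (x - y) - \<phi> x + \<phi> y"
  by (simp add: bregman_div_def inner_vec_def)

lemma objective_inner: "objective \<phi> W x = eta \<phi> x \<bullet> Omega \<phi> W x"
  by (simp add: objective_def inner_vec_def)

lemma D_Omega_inner: "D_Omega \<phi> W x y = eta \<phi> x \<bullet> (Omega \<phi> W x - Omega \<phi> W y)"
  by (simp add: D_Omega_def inner_vec_def)

text \<open>Since \<open>eta\<close> is taken at the first argument only, moving the base point
  changes just a linear pairing and a term free of \<open>x\<close>.\<close>

lemma bregman_div_conversion:
  "bregman_div \<phi> x (conversion \<phi> W \<gamma> y) =
     bregman_div \<phi> x y + (eta \<phi> x \<bullet> Omega \<phi> W y) / \<gamma> + (\<phi> (conversion \<phi> W \<gamma> y) - \<phi> y)"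
  by (simp add: bregman_div_inner conversion_def inner_diff_right)

text \<open>Existence makes the Hilbert choice behind \<open>arg_min_on\<close> a genuine minimiser,
  and in particular a point of \<open>M\<close>.\<close>

lemma is_arg_min_e_projection:
  assumes "e_projection_exists \<phi> M y"
  shows "is_arg_min (\<lambda>x. bregman_div \<phi> x y) (\<lambda>x. x \<in> M) (e_projection \<phi> M y)"
  using assms unfolding e_projection_exists_def e_projection_def arg_min_on_def arg_min_def
  by (rule someI_ex)

lemma objective_e_projection_conversion_le:
  fixes \<phi> W M \<gamma> a
  defines "b \<equiv> e_projection \<phi> M (conversion \<phi> W \<gamma> a)"
  assumes "\<gamma> > 0" and "a \<in> M"
    and ex: "e_projection_exists \<phi> M (conversion \<phi> W \<gamma> a)"
    and D: "D_Omega \<phi> W b a \<le> \<gamma> * bregman_div \<phi> b a"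
  shows "objective \<phi> W b \<le> objective \<phi> W a"
proof -
  have "bregman_div \<phi> b (conversion \<phi> W \<gamma> a) \<le> bregman_div \<phi> a (conversion \<phi> W \<gamma> a)"
    using is_arg_min_e_projection[OF ex] \<open>a \<in> M\<close> by (simp add: is_arg_min_linorder b_def)
  \<comment> \<open>The terms free of the first argument cancel, and the divergence of
    \<open>a\<close> from itself is 0.\<close>
  then have "bregman_div \<phi> b a + (eta \<phi> b \<bullet> Omega \<phi> W a) / \<gamma> \<le> objective \<phi> W a / \<gamma>"
    by (simp add: bregman_div_conversion bregman_div_inner[of \<phi> a a] objective_inner)
  then have "\<gamma> * bregman_div \<phi> b a + eta \<phi> b \<bullet> Omega \<phi> W a \<le> objective \<phi> W a"
    using mult_left_mono[of _ _ \<gamma>] \<open>\<gamma> > 0\<close> by (fastforce simp: distrib_left)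
  \<comment> \<open>\<open>D_Omega \<phi> W b a\<close> is \<open>objective \<phi> W b\<close> minus
    the same mixed pairing of \<open>b\<close> with \<open>a\<close>, which cancels.\<close>
  with D show ?thesis
    by (simp add: D_Omega_inner objective_inner inner_diff_right)
qed

theorem theorem1:
  fixes \<Theta> :: "(real^'d::finite) set"
    and \<phi> :: "real^'d \<Rightarrow> real"
    and u :: "nat \<Rightarrow> real^'d" and d\<^sub>0 :: nat and c :: "nat \<Rightarrow> real"
    and M :: "(real^'d) set"
    and W :: "real^'d \<Rightarrow> real^'d"
    and \<gamma> :: real
    and \<theta> :: "nat \<Rightarrow> real^'d"
  assumes "bregman_system \<Theta> \<phi>"
    and "lin_indep_family u" and "d\<^sub>0 \<le> CARD('d)"
    and "M = mixture_family \<Theta> \<phi> u d\<^sub>0 c"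
    and "convex (eta \<phi> ` M)"
    and "\<gamma> > 0"
    and "\<forall>\<theta>'\<in>M. conversion \<phi> W \<gamma> \<theta>' \<in> \<Theta>"
    and "\<theta> 1 \<in> M"
    and "\<forall>t\<ge>1. e_projection_exists \<phi> M (conversion \<phi> W \<gamma> (\<theta> t))"
    and "\<forall>t\<ge>1. \<theta> (t + 1) = e_projection \<phi> M (conversion \<phi> W \<gamma> (\<theta> t))"
    and "\<forall>t\<ge>1. D_Omega \<phi> W (\<theta> (t + 1)) (\<theta> t) \<le> \<gamma> * bregman_div \<phi> (\<theta> (t + 1)) (\<theta> t)"
  shows "\<forall>t\<ge>1. objective \<phi> W (\<theta> (t + 1)) \<le> objective \<phi> W (\<theta> t)"
proof (intro allI impI)
  fix t :: nat assume "t \<ge> 1"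
  \<comment> \<open>Each iterate has to lie in \<open>M\<close> to compete with its own successor in
    the minimisation.\<close>
  then have "\<theta> t \<in> M"
  proof (induction t rule: dec_induct)
    case base
    show ?case by fact
  next
    case (step n)
    then show ?case
      using is_arg_min_e_projection assms(9,10) by (auto simp: is_arg_min_def)
  qed
  then show "objective \<phi> W (\<theta> (t + 1)) \<le> objective \<phi> W (\<theta> t)"
    using objective_e_projection_conversion_le[of \<gamma> "\<theta> t" M \<phi> W] assms(6,9-11) \<open>t \<ge> 1\<close> by simp
qed

end
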